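(* Let $K$ be a first-countable space. If $K$ is a continuous image of a $2$-fibered compact space, then $K$ is metrizably fibered.
   Context: All spaces are Tychonoff. A space $X$ is metrizably fibered if there are a metrizable space $M$ and a continuous map $f:X\to M$ such that $f^{-1}(z)$ is metrizable for all $z\in M$. A space $X$ is $2$-fibered if there are a metrizable space $M$ and a continuous map $f:X\to M$ such that $|f^{-1}(z)|\leq 2$ for all $z\in M$. *)

theory Defs
  imports "HOL-Analysis.Analysis"
begin

definition Tychonoff_space :: "'a topology \<Rightarrow> bool" where
  "Tychonoff_space X \<longleftrightarrow> completely_regular_space X \<and> Hausdorff_space X"

text \<open>
  In the next two definitions the metrizable target \<open>M\<close> lives on the point type of \<open>X\<close>.
  This loses nothing: only the image of \<open>f\<close> matters, and it can be transported into that type.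
  See the lemmas \<open>metrizably_fiberedI\<close> and \<open>two_fiberedI\<close> below, where the target has
  an arbitrary point type.
\<close>

definition metrizably_fibered :: "'a topology \<Rightarrow> bool" where
  "metrizably_fibered X \<longleftrightarrow>
     (\<exists>(M :: 'a topology) f. metrizable_space M \<and> continuous_map X M f \<and>
        (\<forall>z \<in> topspace M. metrizable_space (subtopology X {x \<in> topspace X. f x = z})))"

definition two_fibered :: "'a topology \<Rightarrow> bool" where
  "two_fibered X \<longleftrightarrow>
     (\<exists>(M :: 'a topology) f. metrizable_space M \<and> continuous_map X M f \<and>
        (\<forall>z \<in> topspace M. finite {x \<in> topspace X. f x = z} \<and> card {x \<in> topspace X. f x = z} \<le> 2))"

lemma metrizable_target_transport:
  fixes X :: "'a topology" and M :: "'b topology"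
  assumes M: "metrizable_space M" and f: "continuous_map X M f"
  obtains N :: "'a topology" and g where
    "metrizable_space N" "continuous_map X N g"
    "\<And>z. z \<in> topspace N \<Longrightarrow>
       \<exists>w \<in> topspace M. {x \<in> topspace X. g x = z} = {x \<in> topspace X. f x = w}"
proof -
  define S where "S = f ` topspace X"
  define r where "r = inv_into (topspace X) f"
  define N where "N = pullback_topology (r ` S) f M"
  have SM: "S \<subseteq> topspace M"
    using f by (auto simp: S_def continuous_map_def)
  have fr: "f (r s) = s" if "s \<in> S" for s
    using that by (simp add: S_def r_def f_inv_into_f)
  have topN: "topspace N = r ` S"
    using SM fr by (auto simp: N_def topspace_pullback_topology)
  have "continuous_map N M (id \<circ> f)"
    unfolding N_def by (rule continuous_map_pullback) simp
  hence cf: "continuous_map N (subtopology M S) f"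
    using fr topN by (auto simp: continuous_map_in_subtopology)
  have cr: "continuous_map (subtopology M S) N r"
    unfolding N_def
  proof (rule continuous_map_pullback')
    show "continuous_map (subtopology M S) M (f \<circ> r)"
      by (rule continuous_map_eq[where f = id]) (auto simp: fr)
    show "topspace (subtopology M S) \<subseteq> r -` (r ` S)" by auto
  qed
  have "homeomorphic_maps N (subtopology M S) f r"
    unfolding homeomorphic_maps_def using cf cr topN fr by auto
  hence "N homeomorphic_space subtopology M S"
    unfolding homeomorphic_space_def by blast
  hence mN: "metrizable_space N"
    using M homeomorphic_metrizable_space metrizable_space_subtopology by blast
  have cg: "continuous_map X N (r \<circ> f)"
    by (rule continuous_map_compose[OF _ cr]) (use f in \<open>auto simp: continuous_map_in_subtopology S_def\<close>)
  have "\<exists>w \<in> topspace M. {x \<in> topspace X. (r \<circ> f) x = z} = {x \<in> topspace X. f x = w}"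
    if "z \<in> topspace N" for z
  proof -
    obtain s where s: "s \<in> S" "z = r s" using \<open>z \<in> topspace N\<close> topN by auto
    have "r (f x) = r s \<longleftrightarrow> f x = s" if "x \<in> topspace X" for x
      using fr s(1) that by (metis S_def imageI)
    then show ?thesis using s SM by auto
  qed
  with mN cg show ?thesis using that by blast
qed

lemma metrizably_fiberedI:
  fixes X :: "'a topology" and M :: "'b topology"
  assumes "metrizable_space M" "continuous_map X M f"
    and "\<And>z. z \<in> topspace M \<Longrightarrow> metrizable_space (subtopology X {x \<in> topspace X. f x = z})"
  shows "metrizably_fibered X"
  unfolding metrizably_fibered_def
  by (rule metrizable_target_transport[OF assms(1,2)]) (metis assms(3))

lemma two_fiberedI:
  fixes X :: "'a topology" and M :: "'b topology"
  assumes "metrizable_space M" "continuous_map X M f"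
    and "\<And>z. z \<in> topspace M \<Longrightarrow>
           finite {x \<in> topspace X. f x = z} \<and> card {x \<in> topspace X. f x = z} \<le> 2"
  shows "two_fibered X"
  unfolding two_fibered_def
  by (rule metrizable_target_transport[OF assms(1,2)]) (metis assms(3))

end

theory Submission
  imports Defs
begin

text \<open>
  Let \<open>f : X \<rightarrow> M\<close> have fibres of at most two points, and call \<open>k, l \<in> K\<close> adjacent if
  \<open>k = g x\<close> and \<open>l = g y\<close> with \<open>f x = f y\<close>. The set \<open>N k\<close> of neighbours of \<open>k\<close> is closed.
  The topology of \<open>M\<close> provides countably many closed subsets of \<open>X\<close>; separating those pairs of
  them that have disjoint images in \<open>K\<close> by Urysohn functions gives a map \<open>h\<close> from \<open>K\<close> to a
  metrizable space such that \<open>N k\<close> meets \<open>N l\<close> whenever \<open>h k = h l\<close>.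

  Let \<open>L\<close> be a fibre of \<open>h\<close>. If \<open>S \<subseteq> K\<close> is closed and every point of \<open>L\<close> has a neighbour in
  \<open>S\<close>, then \<open>L - U\<close> is metrizable for every open \<open>U \<supseteq> S\<close>: on the preimage of \<open>K - U\<close> in the
  relevant fibres \<open>f\<close> is injective, as one of the at most two points of each such fibre is mapped
  into \<open>S\<close>. If some \<open>m \<in> L\<close> lies in all \<open>N k\<close>, \<open>k \<in> L\<close>, take \<open>S = {m}\<close>; as \<open>m\<close> has a countable
  neighbourhood base, \<open>L - {m}\<close> is a countable union of sets \<open>L - U\<close>. Otherwise take \<open>S = N k\<close>,
  \<open>k \<in> L\<close>; the sets \<open>K - N k\<close> cover \<open>L\<close>, so by compactness finitely many sets \<open>L - U\<close> do.
  In both cases \<open>L\<close> is a compact Hausdorff space with a countable network, hence metrizable.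
\<close>

section \<open>Tools from compactness and normality\<close>

text \<open>Finite intersection property of the sets \<open>C \<inter> D\<close>: closure under
  binary intersections lets a single member of \<open>\<D>\<close> do the work of finitely
  many.\<close>

lemma compact_space_directed_Inter:
  assumes X: "compact_space X"
    and ne: "\<D> \<noteq> {}"
    and cl: "\<And>D. D \<in> \<D> \<Longrightarrow> closedin X D"
    and dir: "\<And>D E. D \<in> \<D> \<Longrightarrow> E \<in> \<D> \<Longrightarrow> D \<inter> E \<in> \<D>"
    and C: "closedin X C"
    and disj: "C \<inter> \<Inter>\<D> = {}"
  obtains D where "D \<in> \<D>" "C \<inter> D = {}"
proof -
  have fin: "\<exists>D\<in>\<D>. C \<inter> D \<subseteq> \<Inter>\<F>" if "finite \<F>" "\<F> \<subseteq> (\<inter>) C ` \<D>" for \<F>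
    using that
  proof (induction \<F> rule: finite_induct)
    case empty
    then show ?case using ne by auto
  next
    case (insert F \<F>)
    then obtain D E where "D \<in> \<D>" "C \<inter> D \<subseteq> \<Inter>\<F>" "E \<in> \<D>" "F = C \<inter> E"
      by auto
    then show ?case using dir[of D E] by blast
  qed
  have "\<Inter> ((\<inter>) C ` \<D>) = {}"
    using disj ne by auto
  moreover have "\<forall>F \<in> (\<inter>) C ` \<D>. closedin X F"
    using C cl by auto
  ultimately obtain \<F> where "finite \<F>" "\<F> \<subseteq> (\<inter>) C ` \<D>" "\<Inter>\<F> = {}"
    using X unfolding compact_space_fip by metis
  with fin obtain D where "D \<in> \<D>" "C \<inter> D = {}"
    by (metis subset_empty)
  with that show ?thesis by blast
qed

text \<open>Total boundedness supplies a finite net of radius \<open>1/(n+1)\<close> for each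
  \<open>n\<close>; the balls of all these nets form a countable base.\<close>

lemma compact_metrizable_imp_second_countable:
  assumes "compact_space X" "metrizable_space X"
  shows "second_countable X"
proof -
  obtain M d where "Metric_space M d" and X: "X = Metric_space.mtopology M d"
    using assms(2) unfolding metrizable_space_def by blast
  then interpret Metric_space M d by simp
  have "mtotally_bounded M"
    using assms(1) unfolding X by (simp add: compact_space_def compactin_imp_mtotally_bounded)
  then have "\<exists>F. finite F \<and> F \<subseteq> M \<and> M \<subseteq> (\<Union>x\<in>F. mball x (inverse (real (Suc n))))" for n
    unfolding mtotally_bounded_def by auto
  then obtain F where F: "\<And>n. finite (F n)" "\<And>n. F n \<subseteq> M"
    "\<And>n. M \<subseteq> (\<Union>x\<in>F n. mball x (inverse (real (Suc n))))"
    by metis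
  define \<B> where "\<B> = (\<Union>n. (\<lambda>x. mball x (inverse (real (Suc n)))) ` F n)"
  have "countable \<B>"
    unfolding \<B>_def using F(1) by (auto intro: countable_finite)
  moreover have "\<forall>V\<in>\<B>. openin X V"
    unfolding \<B>_def X by auto
  moreover have "\<exists>V\<in>\<B>. x \<in> V \<and> V \<subseteq> U" if U: "openin X U" "x \<in> U" for U x
  proof -
    obtain r where r: "r > 0" "mball x r \<subseteq> U" and xM: "x \<in> M"
      using U unfolding X by (metis openin_mtopology subsetD)
    obtain n where n: "inverse (real (Suc n)) < r / 2"
      using r(1) reals_Archimedean[of "r/2"] by auto
    obtain y where y: "y \<in> F n" "x \<in> mball y (inverse (real (Suc n)))"
      using F(3) xM by blast
    have "mball y (inverse (real (Suc n))) \<subseteq> mball x r"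
    proof
      fix z assume z: "z \<in> mball y (inverse (real (Suc n)))"
      have "d x z \<le> d x y + d y z"
        using z y xM by (auto intro: triangle)
      moreover have "d x y < r / 2" "d y z < r / 2"
        using z y n by (auto simp: commute)
      ultimately show "z \<in> mball x r" using z xM by auto
    qed
    then show ?thesis using y r(2) unfolding \<B>_def by blast
  qed
  ultimately show ?thesis
    unfolding second_countable_def by (intro exI[of _ \<B>] conjI allI impI) auto
qed

text \<open>One Urysohn function per disjoint pair; there are countably many pairs, so the product
  of real lines indexed by them is metrizable.\<close>

lemma countable_closed_family_separated:
  fixes X :: "'a topology"
  assumes "compact_space X" "Hausdorff_space X" "countable \<N>"
    and cl: "\<And>A. A \<in> \<N> \<Longrightarrow> closedin X A"
  obtains M :: "('a set \<times> 'a set \<Rightarrow> real) topology" and h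
  where "metrizable_space M" "continuous_map X M h"
    "\<And>A B x y. A \<in> \<N> \<Longrightarrow> B \<in> \<N> \<Longrightarrow> A \<inter> B = {} \<Longrightarrow> x \<in> A \<Longrightarrow> y \<in> B \<Longrightarrow> h x \<noteq> h y"
proof -
  define I where "I = {p \<in> \<N> \<times> \<N>. fst p \<inter> snd p = {}}"
  have "normal_space X"
    using assms by (simp add: compact_Hausdorff_or_regular_imp_normal_space)
  then have "\<exists>u. continuous_map X euclideanreal u \<and> u ` fst p \<subseteq> {0} \<and> u ` snd p \<subseteq> {1}"
    if "p \<in> I" for p
    using that cl unfolding normal_space_iff_Urysohn_alt I_def disjnt_def by auto
  then obtain u where u: "\<And>p. p \<in> I \<Longrightarrow> continuous_map X euclideanreal (u p)"
    "\<And>p. p \<in> I \<Longrightarrow> u p ` fst p \<subseteq> {0} \<and> u p ` snd p \<subseteq> {1}"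
    by metis
  \<comment> \<open>Restriction to \<open>I\<close> makes \<open>h x\<close> extensional, as the
    points of \<open>powertop_real I\<close> must be.\<close>
  define h where "h = (\<lambda>x. \<lambda>p\<in>I. u p x)"
  have "countable I"
    unfolding I_def using assms(3) by (auto intro: countable_subset)
  then have "metrizable_space (powertop_real I)"
    unfolding metrizable_space_product_topology
    by (auto simp: metrizable_space_euclidean intro: countable_subset)
  moreover have "continuous_map X (powertop_real I) h"
    unfolding h_def continuous_map_componentwise using u(1) by (auto simp: continuous_map_def)
  moreover have "h x \<noteq> h y" if "A \<in> \<N>" "B \<in> \<N>" "A \<inter> B = {}" "x \<in> A" "y \<in> B" for A B x y
  proof -
    have "(A, B) \<in> I" using that by (simp add: I_def)
    then have "h x (A, B) = 0" "h y (A, B) = 1"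
      using u(2)[of "(A, B)"] that by (auto simp: h_def)
    then show ?thesis by auto
  qed
  ultimately show ?thesis using that by blast
qed

section \<open>Countable networks of closed sets\<close>

text \<open>The members of the network need not be contained in \<open>C\<close>.\<close>

definition closed_network_on :: "'a topology \<Rightarrow> 'a set \<Rightarrow> 'a set set \<Rightarrow> bool" where
  "closed_network_on X C \<N> \<longleftrightarrow> countable \<N> \<and> (\<forall>A\<in>\<N>. closedin X A) \<and>
     (\<forall>x\<in>C. \<forall>U. openin X U \<and> x \<in> U \<longrightarrow> (\<exists>A\<in>\<N>. x \<in> A \<and> A \<subseteq> U))"

lemma closed_network_onE:
  assumes "closed_network_on X C \<N>" "x \<in> C" "openin X U" "x \<in> U"
  obtains A where "A \<in> \<N>" "x \<in> A" "A \<subseteq> U"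
  using assms unfolding closed_network_on_def by metis

lemma closed_network_on_subset:
  "closed_network_on X C \<N> \<Longrightarrow> D \<subseteq> C \<Longrightarrow> closed_network_on X D \<N>"
  unfolding closed_network_on_def by (simp add: subset_iff)

lemma closed_network_on_UN:
  assumes "countable I" "\<And>i. i \<in> I \<Longrightarrow> \<exists>\<N>. closed_network_on X (C i) \<N>"
  shows "\<exists>\<N>. closed_network_on X (\<Union>i\<in>I. C i) \<N>"
proof -
  obtain \<N> where N: "\<And>i. i \<in> I \<Longrightarrow> closed_network_on X (C i) (\<N> i)"
    using assms(2) by metis
  have "\<exists>A\<in>(\<Union>i\<in>I. \<N> i). x \<in> A \<and> A \<subseteq> U"
    if x: "x \<in> (\<Union>i\<in>I. C i)" and U: "openin X U" "x \<in> U" for x U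
  proof -
    obtain i where i: "i \<in> I" "x \<in> C i" using x by blast
    obtain A where "A \<in> \<N> i" "x \<in> A" "A \<subseteq> U"
      using closed_network_onE[OF N[OF i(1)] i(2) U] .
    with i(1) show ?thesis by blast
  qed
  moreover have "countable (\<Union>i\<in>I. \<N> i)" "\<forall>A\<in>(\<Union>i\<in>I. \<N> i). closedin X A"
    using assms(1) N by (auto simp: closed_network_on_def)
  ultimately have "closed_network_on X (\<Union>i\<in>I. C i) (\<Union>i\<in>I. \<N> i)"
    unfolding closed_network_on_def by simp
  then show ?thesis by blast
qed

lemma closed_network_on_singleton:
  "closedin X {x} \<Longrightarrow> closed_network_on X {x} {{x}}"
  unfolding closed_network_on_def by auto

text \<open>Unlike bases, networks survive continuous images; closedness of \<open>g\<close> keeps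
  their members closed.\<close>

lemma closed_network_on_image:
  assumes "closed_network_on X C \<N>" "C \<subseteq> topspace X" "continuous_map X Y g" "closed_map X Y g"
  shows "closed_network_on Y (g ` C) ((`) g ` \<N>)"
proof -
  have "\<exists>B\<in>(`) g ` \<N>. g x \<in> B \<and> B \<subseteq> U" if x: "x \<in> C" "openin Y U" "g x \<in> U" for x U
  proof -
    have "openin X {x \<in> topspace X. g x \<in> U}" "x \<in> {x \<in> topspace X. g x \<in> U}"
      using that assms(2,3) openin_continuous_map_preimage by blast+
    then obtain A where "A \<in> \<N>" "x \<in> A" "A \<subseteq> {x \<in> topspace X. g x \<in> U}"
      using closed_network_onE[OF assms(1) x(1)] by metis
    then show ?thesis by blast
  qed
  moreover have "countable ((`) g ` \<N>)" "\<forall>B\<in>(`) g ` \<N>. closedin Y B"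
    using assms(1,4) by (auto simp: closed_network_on_def closed_map_def)
  ultimately show ?thesis
    unfolding closed_network_on_def by simp
qed

text \<open>Distinct points of \<open>C\<close> lie in disjoint members of the network, so the map
  separating such members is injective on \<open>C\<close> and, by compactness, an
  embedding.\<close>

lemma closed_network_on_imp_metrizable:
  fixes X :: "'a topology"
  assumes "compact_space X" "Hausdorff_space X" "closedin X C" "closed_network_on X C \<N>"
  shows "metrizable_space (subtopology X C)"
proof -
  have N: "countable \<N>" "\<And>A. A \<in> \<N> \<Longrightarrow> closedin X A"
    using assms(4) by (auto simp: closed_network_on_def)
  obtain M :: "('a set \<times> 'a set \<Rightarrow> real) topology" and h
    where M: "metrizable_space M" "continuous_map X M h"
      and sep: "\<And>A B x y. A \<in> \<N> \<Longrightarrow> B \<in> \<N> \<Longrightarrow> A \<inter> B = {} \<Longrightarrow> x \<in> A \<Longrightarrow> y \<in> B \<Longrightarrow> h x \<noteq> h y"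
    using countable_closed_family_separated[OF assms(1,2) N] by metis
  have inj: "inj_on h C"
  proof (rule inj_onI, rule ccontr)
    fix x y assume xy: "x \<in> C" "y \<in> C" "h x = h y" "x \<noteq> y"
    then have "x \<in> topspace X" "y \<in> topspace X"
      using closedin_subset[OF assms(3)] by auto
    then obtain U V where UV: "openin X U" "openin X V" "x \<in> U" "y \<in> V" "disjnt U V"
      using assms(2) xy(4) unfolding Hausdorff_space_def by metis
    obtain A where "A \<in> \<N>" "x \<in> A" "A \<subseteq> U"
      using closed_network_onE[OF assms(4) xy(1) UV(1,3)] .
    moreover obtain B where "B \<in> \<N>" "y \<in> B" "B \<subseteq> V"
      using closed_network_onE[OF assms(4) xy(2) UV(2,4)] .
    ultimately show False
      using UV(5) xy(3) sep[of A B x y]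
      by (auto simp: disjnt_def)
  qed
  have "embedding_map (subtopology X C) M h"
  proof (rule continuous_imp_embedding_map)
    show "compact_space (subtopology X C)"
      using assms by (simp add: closedin_compact_space compact_space_subtopology)
    show "inj_on h (topspace (subtopology X C))"
      using inj by (simp add: inj_on_Int)
  qed (use M in \<open>auto simp: continuous_map_from_subtopology metrizable_imp_Hausdorff_space\<close>)
  then show ?thesis
    using M(1) embedding_map_imp_homeomorphic_space homeomorphic_metrizable_space
      metrizable_space_subtopology by metis
qed

section \<open>Maps from a compact space to a metrizable space\<close>

text \<open>Outer approximation: by the last property the members of \<open>\<A>\<close> containing
  a closed \<open>C\<close> intersect inside the \<open>f\<close>-saturation of \<open>C\<close>.
  The other properties prepare for \<open>compact_space_directed_Inter\<close>, which then picks a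
  single member.\<close>

lemma countable_closed_family_refining_fibres:
  assumes "compact_space X" "metrizable_space M" "continuous_map X M f"
  obtains \<A> where "countable \<A>" "topspace X \<in> \<A>" "\<And>A. A \<in> \<A> \<Longrightarrow> closedin X A"
    "\<And>A B. A \<in> \<A> \<Longrightarrow> B \<in> \<A> \<Longrightarrow> A \<inter> B \<in> \<A>"
    "\<And>C x. closedin X C \<Longrightarrow> x \<in> topspace X \<Longrightarrow> f x \<notin> f ` C \<Longrightarrow> \<exists>A\<in>\<A>. C \<subseteq> A \<and> x \<notin> A"
proof -
  \<comment> \<open>Passing to the image of \<open>f\<close> makes the target compact, hence second
    countable.\<close>
  define N where "N = subtopology M (f ` topspace X)"
  have fN: "continuous_map X N f"
    using assms(3) by (auto simp: N_def continuous_map_in_subtopology)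
  have "metrizable_space N"
    using assms(2) by (simp add: N_def metrizable_space_subtopology)
  moreover have "compact_space N"
    using image_compactin[OF _ assms(3), of "topspace X"] assms(1)
    by (simp add: N_def compact_space_def[of X] compact_space_subtopology)
  ultimately obtain \<B> where B: "countable \<B>" "\<And>V. V \<in> \<B> \<Longrightarrow> openin N V"
    "\<And>U x. openin N U \<Longrightarrow> x \<in> U \<Longrightarrow> \<exists>V\<in>\<B>. x \<in> V \<and> V \<subseteq> U"
    using compact_metrizable_imp_second_countable unfolding second_countable_def by metis
  have "closed_map X N f"
    using fN assms(1) \<open>metrizable_space N\<close>
    by (simp add: continuous_imp_closed_map metrizable_imp_Hausdorff_space)
  \<comment> \<open>Complements of preimages of finite unions of basic sets. Intersecting two of
    them amounts to uniting their families; the empty family gives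
    \<open>topspace X\<close>.\<close>
  define P where "P = (\<lambda>\<F>. {x \<in> topspace X. f x \<notin> \<Union>\<F>})"
  define \<A> where "\<A> = P ` {\<F>. finite \<F> \<and> \<F> \<subseteq> \<B>}"
  show ?thesis
  proof
    show "countable \<A>"
      unfolding \<A>_def using B(1) by (simp add: countable_Collect_finite_subset)
    show "topspace X \<in> \<A>"
      unfolding \<A>_def by (rule image_eqI[of _ _ "{}"]) (auto simp: P_def)
    show "closedin X A" if A: "A \<in> \<A>" for A
    proof -
      obtain \<F> where F: "\<F> \<subseteq> \<B>" "A = P \<F>" using A by (auto simp: \<A>_def)
      have "openin N (\<Union>\<F>)" using F(1) B(2) by blast
      then have "openin X {x \<in> topspace X. f x \<in> \<Union>\<F>}"
        using fN openin_continuous_map_preimage by blast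
      moreover have "A = topspace X - {x \<in> topspace X. f x \<in> \<Union>\<F>}"
        unfolding F(2) P_def by blast
      ultimately show ?thesis by blast
    qed
    show "A \<inter> A' \<in> \<A>" if A: "A \<in> \<A>" "A' \<in> \<A>" for A A'
    proof -
      obtain \<F> \<F>' where "finite \<F>" "\<F> \<subseteq> \<B>" "A = P \<F>" "finite \<F>'" "\<F>' \<subseteq> \<B>" "A' = P \<F>'"
        using A by (auto simp: \<A>_def)
      then show ?thesis
        unfolding \<A>_def by (intro image_eqI[of _ _ "\<F> \<union> \<F>'"]) (auto simp: P_def)
    qed
    show "\<exists>A\<in>\<A>. C \<subseteq> A \<and> x \<notin> A" if "closedin X C" "x \<in> topspace X" "f x \<notin> f ` C" for C x
    proof -
      have "openin N (topspace N - f ` C)"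
        using \<open>closed_map X N f\<close> that(1) unfolding closed_map_def by blast
      moreover have "f x \<in> topspace N - f ` C"
        using that fN by (auto simp: continuous_map_def)
      ultimately obtain V where V: "V \<in> \<B>" "f x \<in> V" "V \<subseteq> topspace N - f ` C"
        using B(3) by blast
      then have "P {V} \<in> \<A>" by (auto simp: \<A>_def)
      moreover have "C \<subseteq> P {V}" "x \<notin> P {V}"
        using V closedin_subset[OF that(1)] by (auto simp: P_def)
      ultimately show ?thesis by blast
    qed
  qed
qed

text \<open>Each fibre of \<open>f\<close> meets \<open>G\<close> in at most one point, so closed
  sets squeezing onto the fibres trace a network on \<open>G\<close>.\<close>

lemma closed_network_on_inj_on:
  assumes "compact_space X" "metrizable_space M" "continuous_map X M f"
    and G: "closedin X G" "inj_on f G"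
  shows "\<exists>\<N>. closed_network_on X G \<N>"
proof -
  obtain \<A> where A: "countable \<A>" "topspace X \<in> \<A>" "\<And>A. A \<in> \<A> \<Longrightarrow> closedin X A"
    "\<And>A B. A \<in> \<A> \<Longrightarrow> B \<in> \<A> \<Longrightarrow> A \<inter> B \<in> \<A>"
    "\<And>C x. closedin X C \<Longrightarrow> x \<in> topspace X \<Longrightarrow> f x \<notin> f ` C \<Longrightarrow> \<exists>A\<in>\<A>. C \<subseteq> A \<and> x \<notin> A"
    using countable_closed_family_refining_fibres[OF assms(1-3)] by metis
  have GX: "G \<subseteq> topspace X" using G(1) closedin_subset by blast
  have Hausd: "Hausdorff_space M" using assms(2) by (rule metrizable_imp_Hausdorff_space)
  have "\<exists>A\<in>\<A>. x \<in> G \<inter> A \<and> G \<inter> A \<subseteq> U" if x: "x \<in> G" and U: "openin X U" "x \<in> U" for x U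
  proof -
    define F where "F = {y \<in> topspace X. f y = f x}"
    have "f x \<in> topspace M"
      using assms(3) x GX by (auto simp: continuous_map_def)
    then have "closedin M {f x}"
      using Hausd by (simp add: closedin_Hausdorff_singleton)
    then have F: "closedin X F"
      using closedin_continuous_map_preimage[OF assms(3), of "{f x}"] by (simp add: F_def)
    \<comment> \<open>In the fibre \<open>F\<close> only \<open>x\<close> belongs to
      \<open>G\<close>. Hence every point of \<open>G - U\<close> is excluded by some member
      containing \<open>F\<close>, and by compactness one member excludes them all.\<close>
    have "\<exists>A. A \<in> {A \<in> \<A>. F \<subseteq> A} \<and> (G - U) \<inter> A = {}"
    proof (rule compact_space_directed_Inter[OF assms(1), of "{A \<in> \<A>. F \<subseteq> A}" "G - U"])
      show "closedin X (G - U)" using G U by blast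
      have "\<exists>A\<in>\<A>. F \<subseteq> A \<and> y \<notin> A" if "y \<in> G" "y \<notin> U" for y
      proof (rule A(5)[OF F])
        show "f y \<notin> f ` F"
          using that x U G(2) unfolding F_def inj_on_def by fastforce
      qed (use that GX in blast)
      then show "(G - U) \<inter> \<Inter>{A \<in> \<A>. F \<subseteq> A} = {}" by blast
    qed (use A F_def in auto)
    then show ?thesis using x GX F_def by blast
  qed
  then have "closed_network_on X G ((\<inter>) G ` \<A>)"
    unfolding closed_network_on_def using A(1,3) G(1) by auto
  then show ?thesis by blast
qed

text \<open>The network is found in \<open>X\<close>, on a closed set \<open>G\<close> where
  \<open>f\<close> is injective, and pushed forward by \<open>g\<close> to a set covering
  \<open>L - U\<close>.\<close>

lemma closed_network_on_avoiding:
  assumes X: "compact_space X" and M: "metrizable_space M" and f: "continuous_map X M f"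
    and fib: "\<And>z. z \<in> topspace M \<Longrightarrow>
      finite {x \<in> topspace X. f x = z} \<and> card {x \<in> topspace X. f x = z} \<le> 2"
    and K: "Hausdorff_space K" and g: "continuous_map X K g"
    and S: "closedin K S" and U: "openin K U" "S \<subseteq> U"
    and link: "\<And>l. l \<in> L \<Longrightarrow>
      \<exists>x\<in>topspace X. \<exists>y\<in>topspace X. g x = l \<and> f x = f y \<and> g y \<in> S"
  shows "\<exists>\<N>. closed_network_on K (L - U) \<N>"
proof -
  define Y where "Y = {y \<in> topspace X. g y \<in> S}"
  \<comment> \<open>Points mapped outside \<open>U\<close> whose fibre also contains a point of
    \<open>Y\<close>. As \<open>S \<subseteq> U\<close>, that point is not in \<open>G\<close>; with
    two points of \<open>G\<close> it would make a fibre of three.\<close>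
  define G where "G = {x \<in> topspace X. g x \<in> topspace K - U} \<inter> {x \<in> topspace X. f x \<in> f ` Y}"
  have "closedin X Y"
    unfolding Y_def using g S by (rule closedin_continuous_map_preimage)
  moreover have "closed_map X M f"
    using f X M by (simp add: continuous_imp_closed_map metrizable_imp_Hausdorff_space)
  ultimately have "closedin M (f ` Y)" by (simp add: closed_map_def)
  then have G: "closedin X G"
    unfolding G_def using U(1) f g by (intro closedin_Int closedin_continuous_map_preimage) auto
  have "inj_on f G"
  proof (rule inj_onI, rule ccontr)
    fix x x' assume xx: "x \<in> G" "x' \<in> G" "f x = f x'" "x \<noteq> x'"
    then obtain y where y: "y \<in> topspace X" "g y \<in> S" "f y = f x"
      by (auto simp: G_def Y_def)
    let ?F = "{u \<in> topspace X. f u = f x}"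
    have "f x \<in> topspace M" using xx(1) f by (auto simp: G_def continuous_map_def)
    then have F: "finite ?F" "card ?F \<le> 2" using fib by auto
    have "y \<noteq> x" "y \<noteq> x'" using xx y U(2) by (auto simp: G_def)
    then have "card {x, x', y} = 3" using xx(4) by auto
    moreover have "{x, x', y} \<subseteq> ?F" using xx y by (auto simp: G_def)
    ultimately show False using F card_mono[of ?F "{x, x', y}"] by linarith
  qed
  then obtain \<N> where N: "closed_network_on X G \<N>"
    using closed_network_on_inj_on[OF X M f G] by blast
  have "closed_map X K g" using g X K by (simp add: continuous_imp_closed_map)
  then have "closed_network_on K (g ` G) ((`) g ` \<N>)"
    using closed_network_on_image[OF N _ g] closedin_subset[OF G] by blast
  moreover have "L - U \<subseteq> g ` G"
  proof
    fix l assume l: "l \<in> L - U"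
    then obtain x y where "x \<in> topspace X" "y \<in> topspace X" "g x = l" "f x = f y" "g y \<in> S"
      using link by blast
    moreover from this have "l \<in> topspace K" using g by (auto simp: continuous_map_def)
    ultimately show "l \<in> g ` G" using l by (auto simp: G_def Y_def)
  qed
  ultimately show ?thesis using closed_network_on_subset by metis
qed

section \<open>Adjacency in \<open>K\<close> and the map \<open>h\<close>\<close>

theorem theorem1p3:
  fixes K :: "'k topology" and X :: "'x topology" and g :: "'x \<Rightarrow> 'k"
  assumes "Tychonoff_space K"
    and "first_countable K"
    and "Tychonoff_space X"
    and "compact_space X"
    and "two_fibered X"
    and "continuous_map X K g"
    and "g ` topspace X = topspace K"
  shows "metrizably_fibered K"
proof -
  note X = assms(4) and g = assms(6) and onto = assms(7)
  have K: "compact_space K" "Hausdorff_space K"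
    using assms image_compactin[of X "topspace X" K g]
    by (auto simp: Tychonoff_space_def compact_space_def)
  obtain M :: "'x topology" and f where M: "metrizable_space M" and f: "continuous_map X M f"
    and fib: "\<And>z. z \<in> topspace M \<Longrightarrow>
      finite {x \<in> topspace X. f x = z} \<and> card {x \<in> topspace X. f x = z} \<le> 2"
    using assms(5) unfolding two_fibered_def by metis
  have cg: "closed_map X K g" using g X K by (simp add: continuous_imp_closed_map)
  have cf: "closed_map X M f"
    using f X M by (simp add: continuous_imp_closed_map metrizable_imp_Hausdorff_space)
  define F where "F = (\<lambda>k. {x \<in> topspace X. g x = k})"
  \<comment> \<open>\<open>W k\<close> is the \<open>f\<close>-saturation of the fibre
    \<open>F k\<close>; its image under \<open>g\<close> consists of the neighbours of
    \<open>k\<close>.\<close>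
  define W where "W = (\<lambda>k. {x \<in> topspace X. f x \<in> f ` F k})"
  define N where "N = (\<lambda>k. g ` W k)"
  have F: "closedin X (F k)" if "k \<in> topspace K" for k
    using closedin_continuous_map_preimage[OF g, of "{k}"] that K(2)
    by (simp add: F_def closedin_Hausdorff_singleton)
  have W: "closedin X (W k)" if "k \<in> topspace K" for k
    using F[OF that] cf f closedin_continuous_map_preimage[OF f, of "f ` F k"]
    by (simp add: W_def closed_map_def)
  have N: "closedin K (N k)" if "k \<in> topspace K" for k
    using W[OF that] cg by (simp add: N_def closed_map_def)
  \<comment> \<open>This is the shape of the hypothesis \<open>link\<close> of
    \<open>closed_network_on_avoiding\<close>.\<close>
  have N_iff: "n \<in> N k \<longleftrightarrow> (\<exists>x\<in>topspace X. \<exists>y\<in>topspace X. g x = k \<and> f x = f y \<and> g y = n)"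
    for n k
    by (auto simp: N_def W_def F_def image_iff) metis+
  obtain \<A> where A: "countable \<A>" "topspace X \<in> \<A>" "\<And>A. A \<in> \<A> \<Longrightarrow> closedin X A"
    "\<And>A B. A \<in> \<A> \<Longrightarrow> B \<in> \<A> \<Longrightarrow> A \<inter> B \<in> \<A>"
    "\<And>C x. closedin X C \<Longrightarrow> x \<in> topspace X \<Longrightarrow> f x \<notin> f ` C \<Longrightarrow> \<exists>A\<in>\<A>. C \<subseteq> A \<and> x \<notin> A"
    using countable_closed_family_refining_fibres[OF X M f] by metis
  have "countable ((`) g ` \<A>)" "\<And>B. B \<in> (`) g ` \<A> \<Longrightarrow> closedin K B"
    using A cg by (auto simp: closed_map_def)
  from countable_closed_family_separated[OF K this]
  obtain Z :: "('k set \<times> 'k set \<Rightarrow> real) topology" and h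
    where Z: "metrizable_space Z" and h: "continuous_map K Z h"
      and sep: "\<And>A B x y. A \<in> (`) g ` \<A> \<Longrightarrow> B \<in> (`) g ` \<A> \<Longrightarrow> A \<inter> B = {} \<Longrightarrow>
        x \<in> A \<Longrightarrow> y \<in> B \<Longrightarrow> h x \<noteq> h y"
    by metis

  \<comment> \<open>Common neighbours of points in one fibre of \<open>h\<close>\<close>
  have W_approx: "\<exists>A\<in>\<A>. F k \<subseteq> A \<and> g ` A \<inter> T = {}"
    if k: "k \<in> topspace K" and T: "closedin K T" "N k \<inter> T = {}" for k T
  proof -
    let ?C = "{x \<in> topspace X. g x \<in> T}"
    have "\<exists>A. A \<in> {A \<in> \<A>. F k \<subseteq> A} \<and> ?C \<inter> A = {}"
    proof (rule compact_space_directed_Inter[OF X, of "{A \<in> \<A>. F k \<subseteq> A}" ?C])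
      show "closedin X ?C" using g T(1) by (rule closedin_continuous_map_preimage)
      \<comment> \<open>The members of \<open>\<A>\<close> containing \<open>F k\<close> intersect
        inside \<open>W k\<close>, and \<open>W k\<close> misses \<open>?C\<close> because
        \<open>N k\<close> misses \<open>T\<close>.\<close>
      have "\<exists>A\<in>\<A>. F k \<subseteq> A \<and> y \<notin> A" if "y \<in> ?C" for y
      proof (rule A(5)[OF F[OF k]])
        show "f y \<notin> f ` F k"
          using that T(2) by (auto simp: N_def W_def)
      qed (use that in simp)
      then show "?C \<inter> \<Inter>{A \<in> \<A>. F k \<subseteq> A} = {}" by blast
    qed (use A F_def in auto)
    then obtain A' where "A' \<in> \<A>" "F k \<subseteq> A'" "?C \<inter> A' = {}" by blast
    moreover from this have "A' \<subseteq> topspace X" using A(3) closedin_subset by blast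
    ultimately show ?thesis by blast
  qed
  have meet: "N k \<inter> N l \<noteq> {}" if kl: "k \<in> topspace K" "l \<in> topspace K" "h k = h l" for k l
  proof
    assume "N k \<inter> N l = {}"
    \<comment> \<open>Approximate twice: first \<open>F k\<close> by a set whose image avoids
      \<open>N l\<close>, then \<open>F l\<close> by a set whose image avoids the image of
      \<open>A1\<close>. The two images are disjoint, so \<open>h\<close> separates them.\<close>
    then obtain A1 where A1: "A1 \<in> \<A>" "F k \<subseteq> A1" "g ` A1 \<inter> N l = {}"
      using W_approx[of k "N l"] N kl by blast
    moreover have "closedin K (g ` A1)" using A1(1) A(3) cg by (simp add: closed_map_def)
    ultimately obtain A2 where A2: "A2 \<in> \<A>" "F l \<subseteq> A2" "g ` A2 \<inter> g ` A1 = {}"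
      using W_approx[of l "g ` A1"] kl by blast
    have "k \<in> g ` topspace X" "l \<in> g ` topspace X" using kl onto by simp_all
    then have "k \<in> g ` A1" "l \<in> g ` A2" using A1(2) A2(2) unfolding F_def by blast+
    moreover have "g ` A1 \<inter> g ` A2 = {}" using A2(3) by (simp add: Int_commute)
    ultimately have "h k \<noteq> h l"
      using sep[of "g ` A1" "g ` A2" k l] A1(1) A2(1) by simp
    then show False using kl by simp
  qed

  \<comment> \<open>Metrizability of the fibres of \<open>h\<close>\<close>
  show ?thesis
  proof (rule metrizably_fiberedI[OF Z h])
    fix z assume z: "z \<in> topspace Z"
    define L where "L = {k \<in> topspace K. h k = z}"
    have LK: "L \<subseteq> topspace K" by (auto simp: L_def)
    have "closedin Z {z}"
      using z Z by (simp add: closedin_Hausdorff_singleton metrizable_imp_Hausdorff_space)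
    then have L: "closedin K L"
      using closedin_continuous_map_preimage[OF h, of "{z}"] by (simp add: L_def)
    note avoid = closed_network_on_avoiding[OF X M f fib K(2) g, where L = L]
    have "\<exists>\<N>. closed_network_on K L \<N>"
    proof (cases "\<exists>m\<in>L. \<forall>l\<in>L. m \<in> N l")
      case True
      then obtain m where m: "m \<in> L" "\<And>l. l \<in> L \<Longrightarrow> m \<in> N l" by blast
      then have mK: "m \<in> topspace K" using LK by blast
      obtain \<B> where B: "countable \<B>" "\<And>V. V \<in> \<B> \<Longrightarrow> openin K V"
        "\<And>U. openin K U \<Longrightarrow> m \<in> U \<Longrightarrow> \<exists>V\<in>\<B>. m \<in> V \<and> V \<subseteq> U"
        using assms(2) mK unfolding first_countable_def by metis
      have clm: "closedin K {m}" using mK K(2) by (simp add: closedin_Hausdorff_singleton)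
      have "\<exists>\<N>. closed_network_on K (L - V) \<N>" if "V \<in> {V \<in> \<B>. m \<in> V}" for V
      proof (rule avoid[OF _ clm])
        show "\<exists>x\<in>topspace X. \<exists>y\<in>topspace X. g x = l \<and> f x = f y \<and> g y \<in> {m}" if "l \<in> L" for l
          using m(2)[OF that] unfolding N_iff by simp
      qed (use that B in auto)
      moreover have "\<exists>\<N>. closed_network_on K {m} \<N>"
        using closed_network_on_singleton[OF clm] by blast
      \<comment> \<open>The point \<open>m\<close> lies in every such \<open>V\<close> and needs a
        piece of its own. Any other \<open>l\<close> is missed by some \<open>V\<close>, as the
        complement of \<open>l\<close> is an open neighbourhood of \<open>m\<close>.\<close>
      moreover define \<C> where "\<C> = insert {m} ((\<lambda>V. L - V) ` {V \<in> \<B>. m \<in> V})"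
      ultimately have "\<exists>\<N>. closed_network_on K (\<Union>C\<in>\<C>. C) \<N>"
        using B(1) by (intro closed_network_on_UN) auto
      moreover have "L \<subseteq> (\<Union>C\<in>\<C>. C)"
      proof
        fix l assume l: "l \<in> L"
        show "l \<in> (\<Union>C\<in>\<C>. C)"
        proof (cases "l = m")
          case False
          have "closedin K {l}" using l LK K(2) by (simp add: closedin_Hausdorff_singleton subsetD)
          then have "openin K (topspace K - {l})" by blast
          then obtain V where "V \<in> \<B>" "m \<in> V" "V \<subseteq> topspace K - {l}"
            using B(3) False mK by blast
          then show ?thesis using l by (auto simp: \<C>_def)
        qed (simp add: \<C>_def)
      qed
      ultimately show ?thesis using closed_network_on_subset by metis
    next
      case False
      have loc: "\<exists>V. openin K V \<and> l \<in> V \<and> (\<exists>\<N>. closed_network_on K (L \<inter> V) \<N>)" if l: "l \<in> L" for l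
      proof -
        obtain k where k: "k \<in> L" "l \<notin> N k" using False l by blast
        then have kK: "k \<in> topspace K" using LK by blast
        have "regular_space K" using K by (simp add: compact_Hausdorff_imp_regular_space)
        moreover have "l \<in> topspace K - N k" using l k LK by blast
        ultimately obtain V where V: "openin K V" "l \<in> V" "disjnt (N k) (K closure_of V)"
          using N[OF kK] unfolding regular_space by blast
        \<comment> \<open>Removing the closure of \<open>V\<close> leaves an open set that still
          contains \<open>N k\<close>, while \<open>V\<close> lies outside it.\<close>
        let ?U = "topspace K - K closure_of V"
        have "\<exists>\<N>. closed_network_on K (L - ?U) \<N>"
        proof (rule avoid[OF _ N[OF kK]])
          show "N k \<subseteq> ?U" using V(3) closedin_subset[OF N[OF kK]] by (auto simp: disjnt_def)
          show "\<exists>x\<in>topspace X. \<exists>y\<in>topspace X. g x = l' \<and> f x = f y \<and> g y \<in> N k" if l': "l' \<in> L" for l'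
          proof -
            \<comment> \<open>\<open>k\<close> and \<open>l'\<close> lie in the same fibre of
              \<open>h\<close>, so they have a common neighbour.\<close>
            obtain n where "n \<in> N l'" "n \<in> N k" using meet[of l' k] l' k by (auto simp: L_def)
            then show ?thesis unfolding N_iff[of n l'] by metis
          qed
        qed auto
        moreover have "L \<inter> V \<subseteq> L - ?U"
          using closure_of_subset[OF openin_subset[OF V(1)]] by blast
        ultimately have "\<exists>\<N>. closed_network_on K (L \<inter> V) \<N>"
          using closed_network_on_subset by metis
        with V show ?thesis by metis
      qed
      then obtain V where V: "\<And>l. l \<in> L \<Longrightarrow> openin K (V l)" "\<And>l. l \<in> L \<Longrightarrow> l \<in> V l"
        "\<And>l. l \<in> L \<Longrightarrow> \<exists>\<N>. closed_network_on K (L \<inter> V l) \<N>"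
        by metis
      \<comment> \<open>Compactness leaves finitely many of the sets \<open>V l\<close>, few enough
        to unite their networks.\<close>
      have "compactin K L" using L K(1) closedin_compact_space by blast
      moreover have "L \<subseteq> \<Union>(V ` L)" using V(2) by blast
      ultimately obtain \<F> where "finite \<F>" "\<F> \<subseteq> V ` L" "L \<subseteq> \<Union>\<F>"
        using compactinD[of K L "V ` L"] V(1) by auto
      then obtain I where I: "finite I" "I \<subseteq> L" "L \<subseteq> \<Union>(V ` I)"
        by (metis finite_subset_image)
      have "\<exists>\<N>. closed_network_on K (\<Union>l\<in>I. L \<inter> V l) \<N>"
        using I V(3) by (intro closed_network_on_UN) (auto intro: countable_finite)
      moreover have "L \<subseteq> (\<Union>l\<in>I. L \<inter> V l)" using I(3) by blast
      ultimately show ?thesis using closed_network_on_subset by metis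
    qed
    then have "metrizable_space (subtopology K L)"
      using closed_network_on_imp_metrizable[OF K L] by blast
    then show "metrizable_space (subtopology K {x \<in> topspace K. h x = z})"
      by (simp add: L_def)
  qed
qed

end
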